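(* Let $d=2$ and let the potential $f$ be differentiable on $(0,1)$, as well as decreasing and logarithmically convex on $(0,1/2]$. Then there exists an $a\in(0,1/2)$ such that the $4$-point configuration $$X_a^{(4)}=\left\{(0,0),\ (a,\tfrac12),\ (\tfrac12,a),\ (\tfrac12+a,\tfrac12+a)\right\}$$ is a minimizer of $E_F$, i.e. $E_F(Y)\ge E_F(X_a^{(4)})$ for every $4$-point configuration $Y$ in $\mathbb T^2$. This value of $a$ satisfies $$f'(a)\,f(1/2)=f'(1/2-a)\,f(1/2-a).$$ If $f$ is strictly logarithmically convex, this value of $a$ is unique.
   Context: $\mathbb T=\mathbb R/\mathbb Z$ is identified with $[0,1)$. A potential $f$ on $\mathbb T$ is viewed as a nonnegative even $1$-periodic function on $\mathbb R$, continuous on $(0,1)$; moreover either $f$ is continuous on all of $\mathbb R$, or it is singular at $0$, i.e. $\lim_{t\to0}f(t)=+\infty$ and $f(0)=+\infty$. "Decreasing" means non-increasing; (strictly) logarithmically convex means $f>0$ and $\log f$ is (strictly) convex on $(0,1/2]$. Energy: $F(t_1,t_2)=f(t_1)f(t_2)$ and, for a (multi)set $X=\{\mathbf x^0,\dots,\mathbf x^{N-1}\}\subset\mathbb T^2$, $E_F(X)=\sum_{k,\ell=0,\,k\ne\ell}^{N-1}f(x_1^k-x_1^\ell)f(x_2^k-x_2^\ell)$. *)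

theory Defs
  imports "HOL-Analysis.Analysis"
begin

text \<open>
  Potentials on the torus \<open>\<real>/\<int>\<close> take values in \<open>[0,\<infinity>]\<close>, so that the value
  \<open>\<infinity>\<close> at a singularity, and hence infinite energies of configurations with coinciding
  coordinates, are genuine. In the first alternative below the clause \<open>f 0 < \<infinity>\<close> is
  needed, because in the topology of \<open>ennreal\<close> a singular potential is continuous as well.
\<close>

definition torus_potential :: "(real \<Rightarrow> ennreal) \<Rightarrow> bool" where
  "torus_potential f \<longleftrightarrow>
     (\<forall>t. f (- t) = f t) \<and>
     (\<forall>t. f (t + 1) = f t) \<and>
     (\<forall>t\<in>{0<..<1}. f t < \<infinity>) \<and>
     continuous_on {0<..<1} f \<and>
     (f 0 < \<infinity> \<and> continuous_on UNIV f \<or> f 0 = \<infinity> \<and> (f \<longlongrightarrow> \<infinity>) (at 0))"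

text \<open>
  The real-valued version of a potential. It is meaningful only where the potential is
  finite (\<open>enn2real \<infinity> = 0\<close>), and is only used on \<open>(0,1)\<close>.
\<close>

definition real_potential :: "(real \<Rightarrow> ennreal) \<Rightarrow> real \<Rightarrow> real" where
  "real_potential f t = enn2real (f t)"

definition log_convex_on :: "real set \<Rightarrow> (real \<Rightarrow> real) \<Rightarrow> bool" where
  "log_convex_on S g \<longleftrightarrow> (\<forall>t\<in>S. g t > 0) \<and> convex_on S (\<lambda>t. ln (g t))"

definition strictly_convex_on :: "real set \<Rightarrow> (real \<Rightarrow> real) \<Rightarrow> bool" where
  "strictly_convex_on S g \<longleftrightarrow>
     convex S \<and>
     (\<forall>x\<in>S. \<forall>y\<in>S. \<forall>u>0. \<forall>v>0.
        x \<noteq> y \<longrightarrow> u + v = 1 \<longrightarrow> g (u * x + v * y) < u * g x + v * g y)"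

definition strictly_log_convex_on :: "real set \<Rightarrow> (real \<Rightarrow> real) \<Rightarrow> bool" where
  "strictly_log_convex_on S g \<longleftrightarrow>
     (\<forall>t\<in>S. g t > 0) \<and> strictly_convex_on S (\<lambda>t. ln (g t))"

definition tensor_potential :: "(real \<Rightarrow> ennreal) \<Rightarrow> real \<times> real \<Rightarrow> ennreal" where
  "tensor_potential f = (\<lambda>(t1, t2). f t1 * f t2)"

text \<open>
  Points of the torus are represented by their coordinates in \<open>[0,1)\<close>, and an \<open>N\<close>-point
  configuration, in which points may be repeated, by a list of length \<open>N\<close>.
\<close>

definition torus2 :: "(real \<times> real) set" where
  "torus2 = {0..<1} \<times> {0..<1}"

definition configuration :: "nat \<Rightarrow> (real \<times> real) list \<Rightarrow> bool" where
  "configuration N X \<longleftrightarrow> length X = N \<and> set X \<subseteq> torus2"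

definition energy :: "(real \<times> real \<Rightarrow> ennreal) \<Rightarrow> (real \<times> real) list \<Rightarrow> ennreal" where
  "energy F X =
     (\<Sum>(k, l)\<in>{(k, l). k < length X \<and> l < length X \<and> k \<noteq> l}. F (X ! k - X ! l))"

definition energy_minimizer ::
  "(real \<times> real \<Rightarrow> ennreal) \<Rightarrow> nat \<Rightarrow> (real \<times> real) list \<Rightarrow> bool" where
  "energy_minimizer F N X \<longleftrightarrow>
     configuration N X \<and> (\<forall>Y. configuration N Y \<longrightarrow> energy F X \<le> energy F Y)"

definition X4 :: "real \<Rightarrow> (real \<times> real) list" where
  "X4 a = [(0, 0), (a, 1/2), (1/2, a), (1/2 + a, 1/2 + a)]"

end

theory Submission
  imports Defs
begin

text \<open>
  The configuration \<open>X\<^sub>a\<close> has energy \<open>4 g(a)\<close> with \<open>g(a) = 2 f(a) f(1/2) + f(1/2 - a)\<^sup>2\<close>. For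
  an arbitrary configuration, compare the cyclic orders of the points in the two coordinates.
  If they agree up to reflection, logarithmic convexity gives the energy bound
  \<open>2 (4 f(1/4)\<^sup>2 + 2 f(1/2)\<^sup>2) \<ge> 4 g(1/4)\<close>. Otherwise two pairs are adjacent in both coordinates
  and each of the other four is adjacent in one coordinate only; bounding \<open>f\<close> by
  \<open>f(1/2)\<close> in the other coordinate and averaging the gaps gives the bound \<open>4 g(a)\<close>, where \<open>a\<close> is
  the mean of the gaps of those four pairs. It remains to minimize \<open>g\<close> on \<open>[0,1/2]\<close>: a minimum is
  attained inside because \<open>f'(1/2) = 0\<close>, and \<open>g\<close> is strictly convex if \<open>f\<close> is strictly
  logarithmically convex.
\<close>

section \<open>Arithmetic and geometric means in \<open>ennreal\<close>\<close>

text \<open>If one summand is infinite, so is the sum; otherwise all values are finite and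
  \<open>(x + y)^2 >= 4 * x * y\<close> applies. The bound \<open>m\<close> in place of a square
  root lets logarithmic midpoint convexity be turned directly into midpoint convexity.\<close>

lemma ennreal_amgm:
  fixes m p q :: ennreal
  assumes "m * m \<le> p * q"
  shows "2 * m \<le> p + q"
proof (cases "p = top \<or> q = top")
  case False
  then have "p * q < top"
    by (simp add: ennreal_mult_less_top less_top)
  then have "m \<noteq> top"
    using assms by auto
  with False obtain x y z where xyz: "p = ennreal x" "q = ennreal y" "m = ennreal z"
    and nonneg: "x \<ge> 0" "y \<ge> 0" "z \<ge> 0"
    by (metis ennreal_cases)
  have "z * z \<le> x * y"
    using assms nonneg by (simp add: xyz ennreal_mult[symmetric] ennreal_le_iff)
  moreover have "4 * (x * y) \<le> (x + y)\<^sup>2"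
    using zero_le_power2[of "x - y"] by (simp add: power2_eq_square algebra_simps)
  ultimately have "(2 * z)\<^sup>2 \<le> (x + y)\<^sup>2"
    by (simp add: power2_eq_square)
  then have "2 * z \<le> x + y"
    by (rule power2_le_imp_le) (use nonneg in simp)
  then have "ennreal (2 * z) \<le> ennreal (x + y)"
    by (rule ennreal_leI)
  then show ?thesis
    using nonneg by (simp add: xyz ennreal_mult ennreal_plus)
qed auto

lemma ennreal_two_mult_le_squares:
  fixes p q :: ennreal
  shows "2 * (p * q) \<le> p * p + q * q"
  by (rule ennreal_amgm) (simp add: mult_ac)

section \<open>Symmetry, continuity, monotonicity and positivity of the potential\<close>

locale log_convex_potential =
  fixes f :: "real \<Rightarrow> ennreal"
  assumes potential: "torus_potential f"
    and antimono: "antimono_on {0<..1/2} f"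
    and log_convex: "log_convex_on {0<..1/2} (real_potential f)"
begin

abbreviation r :: "real \<Rightarrow> real" where
  "r \<equiv> real_potential f"

lemma f_even: "f (- t) = f t"
  using potential by (simp add: torus_potential_def)

sublocale periodic_fun_simple' f
  by unfold_locales (use potential in \<open>simp add: torus_potential_def\<close>)

lemma minus_commute: "f (s - t) = f (t - s)"
  using f_even[of "s - t"] by simp

lemma one_minus: "f (1 - t) = f t"
  using f_even[of t] plus_1[of "- t"] by (simp add: algebra_simps)

lemma f_frac: "f (frac t) = f t"
  using minus_of_int[of t "\<lfloor>t\<rfloor>"] by (simp add: frac_def)

lemma f_finite: "0 < t \<Longrightarrow> t < 1 \<Longrightarrow> f t < \<infinity>"
  using potential by (simp add: torus_potential_def)

lemma f_eq: "f t < \<infinity> \<Longrightarrow> f t = ennreal (r t)"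
  by (simp add: real_potential_def less_top)

lemma r_nonneg: "0 \<le> r t"
  by (simp add: real_potential_def)

lemma r_le_iff: "f s < \<infinity> \<Longrightarrow> f t < \<infinity> \<Longrightarrow> r s \<le> r t \<longleftrightarrow> f s \<le> f t"
  using ennreal_le_iff[OF r_nonneg[of t], of "r s"] f_eq[of s] f_eq[of t] by simp

lemma r_one_minus: "r (1 - t) = r t"
  by (simp add: real_potential_def one_minus)

lemma r_pos:
  assumes "0 < t" "t < 1"
  shows "0 < r t"
proof (cases "t \<le> 1/2")
  case True
  then show ?thesis
    using assms log_convex by (auto simp: log_convex_on_def)
next
  case False
  then have "0 < r (1 - t)"
    using assms log_convex by (auto simp: log_convex_on_def)
  then show ?thesis
    by (simp add: r_one_minus)
qed

text \<open>In \<open>ennreal\<close>, divergence to infinity at a point of value infinity is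
  continuity, so both kinds of potential are continuous at \<open>0\<close>. The reflection
  \<open>s\<close> to \<open>1 - s\<close> carries this over to \<open>1\<close>.\<close>

lemma isCont_f:
  assumes "0 \<le> t" "t \<le> 1"
  shows "isCont f t"
proof -
  have isCont_0: "isCont f 0"
    using potential by (auto simp: torus_potential_def isCont_def continuous_on_def)
  consider "t = 0" | "0 < t" "t < 1" | "t = 1"
    using assms by linarith
  then show ?thesis
  proof cases
    case 1
    with isCont_0 show ?thesis by simp
  next
    case 2
    then show ?thesis
      using potential by (auto simp: torus_potential_def continuous_on_eq_continuous_at)
  next
    case 3
    have "isCont (\<lambda>s. f (1 - s)) 1"
      using isCont_0 by (intro isCont_o2[where f = "\<lambda>s. 1 - s" and g = f]) auto
    with 3 show ?thesis
      by (simp add: one_minus)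
  qed
qed

lemma f_antimono:
  assumes "0 < s" "s \<le> t" "t \<le> 1/2"
  shows "f t \<le> f s"
  using antimono assms by (auto simp: monotone_on_def)

text \<open>Monotonicity on \<open>(0,1/2]\<close> passes to the endpoint \<open>0\<close> by
  right-hand continuity there.\<close>

lemma f_le_f0:
  assumes "0 \<le> t" "t \<le> 1/2"
  shows "f t \<le> f 0"
proof (cases "t = 0")
  case False
  have "(f \<longlongrightarrow> f 0) (at_right 0)"
    using isCont_f[of 0] by (auto simp: isCont_def intro: tendsto_within_subset)
  moreover have "\<forall>\<^sub>F s in at_right 0. f t \<le> f s"
    using False assms by (auto simp: eventually_at_right_field intro!: exI[of _ t] f_antimono)
  ultimately show ?thesis
    by (rule tendsto_lowerbound) simp
qed simp

text \<open>Positivity excludes the form \<open>0 * \<infinity>\<close>, the only obstruction to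
  taking limits of products in \<open>ennreal\<close>. At integers it follows from the comparison
  with \<open>f 0\<close>.\<close>

lemma f_pos:
  shows "0 < f t"
proof -
  have inner: "0 < f s" if "0 < s" "s < 1" for s
    using f_finite[OF that] r_pos[OF that] f_eq[of s] by simp
  have "0 < f (frac t)"
  proof (cases "frac t = 0")
    case True
    then show ?thesis
      using inner[of "1/4"] f_le_f0[of "1/4"] unfolding True by auto
  next
    case False
    then show ?thesis
      using inner[of "frac t"] frac_ge_0[of t] frac_lt_1[of t] by auto
  qed
  then show ?thesis
    by (simp add: f_frac)
qed

section \<open>Logarithmic midpoint convexity on \<open>[0,1]\<close> and its averaged forms\<close>

lemma r_midpoint_half:
  assumes "0 < s" "s \<le> 1/2" "0 < t" "t \<le> 1/2"
  shows "r ((s + t) / 2) * r ((s + t) / 2) \<le> r s * r t"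
proof -
  have m: "0 < r ((s + t) / 2)" "0 < r s" "0 < r t"
    using assms by (auto intro!: r_pos)
  have "convex_on {0<..1/2} (\<lambda>t. ln (r t))"
    using log_convex by (simp add: log_convex_on_def)
  then have "ln (r ((1 - 1/2) *\<^sub>R s + (1/2) *\<^sub>R t)) \<le> (1 - 1/2) * ln (r s) + 1/2 * ln (r t)"
    using assms by (intro convex_onD) auto
  then have "2 * ln (r ((s + t) / 2)) \<le> ln (r s) + ln (r t)"
    by (simp add: add_divide_distrib)
  then have "ln (r ((s + t) / 2) * r ((s + t) / 2)) \<le> ln (r s * r t)"
    using m by (simp add: ln_mult)
  then show ?thesis
    using m by (simp add: ln_le_cancel_iff)
qed

text \<open>Reflecting both points into \<open>(0,1/2]\<close> moves the midpoint closer to \<open>0\<close>.\<close>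

lemma midpoint_inner:
  assumes "0 < s" "s < 1" "0 < t" "t < 1"
  shows "f ((s + t) / 2) * f ((s + t) / 2) \<le> f s * f t"
proof -
  define \<rho> :: "real \<Rightarrow> real" where rho_def: "\<rho> t = min t (1 - t)" for t
  have f_rho: "f (\<rho> t) = f t" for t
    by (simp add: rho_def min_def one_minus)
  have rho: "0 < \<rho> s" "\<rho> s \<le> 1/2" "0 < \<rho> t" "\<rho> t \<le> 1/2"
    using assms by (auto simp: rho_def min_def)
  have "f ((s + t) / 2) = f (\<rho> ((s + t) / 2))"
    by (simp add: f_rho)
  also have "\<dots> \<le> f ((\<rho> s + \<rho> t) / 2)"
  proof (rule f_antimono)
    show "0 < (\<rho> s + \<rho> t) / 2"
      using rho by simp
    have "\<rho> s \<le> s" "\<rho> s \<le> 1 - s" "\<rho> t \<le> t" "\<rho> t \<le> 1 - t"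
      by (simp_all add: rho_def)
    then show "(\<rho> s + \<rho> t) / 2 \<le> \<rho> ((s + t) / 2)"
      unfolding rho_def[of "(s + t) / 2"] by (intro min.boundedI) (simp_all add: field_simps)
    have "\<rho> u \<le> 1/2" for u
      by (simp add: rho_def min_def)
    then show "\<rho> ((s + t) / 2) \<le> 1/2" .
  qed
  finally have "f ((s + t) / 2) * f ((s + t) / 2)
      \<le> f ((\<rho> s + \<rho> t) / 2) * f ((\<rho> s + \<rho> t) / 2)"
    by (intro mult_mono) auto
  also have "\<dots> \<le> f (\<rho> s) * f (\<rho> t)"
  proof -
    let ?m = "(\<rho> s + \<rho> t) / 2"
    have "f ?m < \<infinity>" "f (\<rho> s) < \<infinity>" "f (\<rho> t) < \<infinity>"
      using rho by (intro f_finite; argo)+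
    from this[THEN f_eq] show ?thesis
      using r_midpoint_half[OF rho] by (simp add: ennreal_mult[symmetric] r_nonneg ennreal_leI)
  qed
  finally show ?thesis
    by (simp add: f_rho)
qed

text \<open>The endpoints are reached by a limit: \<open>g x e\<close> pulls \<open>x\<close>
  towards \<open>1/2\<close>, hence into \<open>(0,1)\<close>. It is affine in \<open>x\<close>, so
  it respects midpoints, and the inequality for inner points survives as \<open>e\<close> tends to
  \<open>0\<close>.\<close>

lemma midpoint:
  assumes "s \<in> {0..1}" "t \<in> {0..1}"
  shows "f ((s + t) / 2) * f ((s + t) / 2) \<le> f s * f t"
proof -
  define g where "g x e = x + (1/2 - x) * e" for x e :: real
  have g_inner: "0 < g x e \<and> g x e < 1" if "x \<in> {0..1}" "0 < e" "e < 1" for x e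
  proof -
    have "g x e = (1 - e) * x + e / 2" "(1 - e) * x \<ge> 0" "(1 - e) * x \<le> 1 - e"
    proof -
      show "g x e = (1 - e) * x + e / 2"
        by (simp add: g_def algebra_simps)
      show "(1 - e) * x \<ge> 0" "(1 - e) * x \<le> 1 - e"
        using that by (auto intro: mult_left_le)
    qed
    then show ?thesis
      using that by argo
  qed
  have lim: "((\<lambda>e. f (g x e)) \<longlongrightarrow> f x) (at_right 0)" if "x \<in> {0..1}" for x
  proof (rule isCont_tendsto_compose[where g = f])
    show "isCont f x"
      using that by (intro isCont_f) auto
    have "((\<lambda>e. g x e) \<longlongrightarrow> x + (1/2 - x) * 0) (at_right 0)"
      unfolding g_def by (intro tendsto_intros)
    then show "(g x \<longlongrightarrow> x) (at_right 0)"
      by simp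
  qed
  have nz: "f x \<noteq> 0" for x
    using f_pos[of x] by simp
  have m: "(s + t) / 2 \<in> {0..1}"
    using assms by auto
  show ?thesis
  proof (rule tendsto_le)
    show "((\<lambda>e. f (g s e) * f (g t e)) \<longlongrightarrow> f s * f t) (at_right 0)"
      by (intro tendsto_mult_ennreal lim assms) (use nz in auto)
    show "((\<lambda>e. f (g ((s + t) / 2) e) * f (g ((s + t) / 2) e))
        \<longlongrightarrow> f ((s + t) / 2) * f ((s + t) / 2)) (at_right 0)"
      by (intro tendsto_mult_ennreal lim m) (use nz in auto)
    have "f (g ((s + t) / 2) e) * f (g ((s + t) / 2) e) \<le> f (g s e) * f (g t e)"
      if "0 < e" "e < 1" for e
    proof -
      have "g ((s + t) / 2) e = (g s e + g t e) / 2"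
        by (simp add: g_def field_simps)
      then show ?thesis
        using midpoint_inner[of "g s e" "g t e"] g_inner[OF assms(1) that]
          g_inner[OF assms(2) that] by (simp only:)
    qed
    then show "\<forall>\<^sub>F e in at_right 0. f (g ((s + t) / 2) e) * f (g ((s + t) / 2) e)
        \<le> f (g s e) * f (g t e)"
      by (auto simp: eventually_at_right_field intro!: exI[of _ 1])
  qed simp
qed

lemma mean2: "s \<in> {0..1} \<Longrightarrow> t \<in> {0..1} \<Longrightarrow> 2 * f ((s + t) / 2) \<le> f s + f t"
  by (intro ennreal_amgm midpoint)

lemma mean4:
  assumes "s \<in> {0..1}" "t \<in> {0..1}" "u \<in> {0..1}" "v \<in> {0..1}"
  shows "4 * f ((s + t + u + v) / 4) \<le> f s + f t + f u + f v"
proof -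
  have "4 * f ((s + t + u + v) / 4) = 2 * (2 * f (((s + t) / 2 + (u + v) / 2) / 2))"
    by (simp add: add_divide_distrib add_ac mult.assoc[symmetric])
  also have "\<dots> \<le> 2 * (f ((s + t) / 2) + f ((u + v) / 2))"
    using assms by (intro mult_left_mono mean2) auto
  also have "\<dots> \<le> (f s + f t) + (f u + f v)"
    using mean2[of s t] mean2[of u v] assms by (simp add: distrib_left add_mono)
  finally show ?thesis
    by (simp add: add_ac)
qed

text \<open>Logarithmic convexity is used inside each product and once more between the two
  midpoints \<open>p\<close> and \<open>q\<close>; the inequality of the means joins the two
  levels.\<close>

lemma sum_products2:
  assumes "s \<in> {0..1}" "t \<in> {0..1}" "u \<in> {0..1}" "v \<in> {0..1}"
  shows "2 * (f ((s + t + u + v) / 4) * f ((s + t + u + v) / 4)) \<le> f s * f t + f u * f v"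
proof -
  define p q where "p = (s + t) / 2" and "q = (u + v) / 2"
  have pq: "p \<in> {0..1}" "q \<in> {0..1}" "(s + t + u + v) / 4 = (p + q) / 2"
    using assms by (auto simp: p_def q_def field_simps)
  have "2 * (f ((p + q) / 2) * f ((p + q) / 2)) \<le> 2 * (f p * f q)"
    using pq by (intro mult_left_mono midpoint) auto
  also have "\<dots> \<le> f p * f p + f q * f q"
    by (rule ennreal_two_mult_le_squares)
  also have "\<dots> \<le> f s * f t + f u * f v"
    unfolding p_def q_def using assms by (intro add_mono midpoint)
  finally show ?thesis
    by (simp add: pq)
qed

text \<open>The point \<open>1/2\<close> is the midpoint of \<open>t\<close> and
  \<open>1 - t\<close>, where \<open>f\<close> takes the same value.\<close>

lemma f_half_le: "f (1/2) \<le> f t"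
proof -
  have "frac t \<in> {0..1}"
    using frac_ge_0[of t] frac_lt_1[of t] by auto
  then have "2 * f (1/2) \<le> f (frac t) + f (1 - frac t)"
    using mean2[of "frac t" "1 - frac t"] by simp
  then have "2 * f (1/2) \<le> 2 * f t"
    by (simp add: one_minus f_frac mult_2)
  then show ?thesis
    by (subst (asm) ennreal_mult_le_mult_iff) auto
qed

section \<open>The profile and the cyclic orders of four points\<close>

text \<open>A quarter of the energy of \<open>X4 a\<close>. It is kept in \<open>ennreal\<close>
  because at the endpoints \<open>0\<close> and \<open>1/2\<close> it is infinite for singular
  potentials.\<close>

definition profile :: "real \<Rightarrow> ennreal" where
  "profile a = 2 * (f a * f (1/2)) + f (1/2 - a) * f (1/2 - a)"

text \<open>Up to reflection, four points on a circle have three cyclic orders;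
  a coincidence contributes a gap \<open>0\<close>, so the order need not be unique.\<close>

definition cyclic :: "real \<Rightarrow> real \<Rightarrow> real \<Rightarrow> real \<Rightarrow> bool" where
  "cyclic u v w z \<longleftrightarrow> (\<exists>c0\<in>{0..1}. \<exists>c1\<in>{0..1}. \<exists>c2\<in>{0..1}. \<exists>c3\<in>{0..1}.
     c0 + c1 + c2 + c3 = 1 \<and>
     f (u - v) = f c0 \<and> f (v - w) = f c1 \<and> f (w - z) = f c2 \<and> f (z - u) = f c3)"

lemma cyclic_rotate:
  assumes "cyclic u v w z"
  shows "cyclic v w z u"
proof -
  obtain c0 c1 c2 c3 where c: "c0 \<in> {0..1}" "c1 \<in> {0..1}" "c2 \<in> {0..1}" "c3 \<in> {0..1}"
    "c0 + c1 + c2 + c3 = 1"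
    "f (u - v) = f c0" "f (v - w) = f c1" "f (w - z) = f c2" "f (z - u) = f c3"
    using assms unfolding cyclic_def by blast
  show ?thesis
    unfolding cyclic_def
    by (rule bexI[of _ c1], rule bexI[of _ c2], rule bexI[of _ c3], rule bexI[of _ c0])
      (use c in auto)
qed

lemma cyclic_reflect:
  assumes "cyclic u v w z"
  shows "cyclic u z w v"
proof -
  obtain c0 c1 c2 c3 where c: "c0 \<in> {0..1}" "c1 \<in> {0..1}" "c2 \<in> {0..1}" "c3 \<in> {0..1}"
    "c0 + c1 + c2 + c3 = 1"
    "f (u - v) = f c0" "f (v - w) = f c1" "f (w - z) = f c2" "f (z - u) = f c3"
    using assms unfolding cyclic_def by blast
  show ?thesis
    unfolding cyclic_def
    unfolding minus_commute[of u z] minus_commute[of z w] minus_commute[of w v]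
      minus_commute[of v u]
    by (rule bexI[of _ c3], rule bexI[of _ c2], rule bexI[of _ c1], rule bexI[of _ c0])
      (use c in auto)
qed

text \<open>Walking once around the circle from \<open>u\<close>, the points are met in the order of
  their distances \<open>frac (_ - u)\<close>. The gaps are the successive differences, closed up by
  \<open>1 - frac (z - u)\<close>.\<close>

lemma cyclic_sorted:
  assumes "frac (v - u) \<le> frac (w - u)" "frac (w - u) \<le> frac (z - u)"
  shows "cyclic u v w z"
proof -
  \<comment> \<open>Measuring positions from \<open>u\<close> modulo \<open>1\<close> changes
    differences only by integers, up to the sign reversal that \<open>f\<close> ignores.\<close>
  have f_diff: "f (x - y) = f (frac (y - u) - frac (x - u))" for x y
  proof -
    have "f (x - y) = f (y - x)"
      by (rule minus_commute)
    also have "\<dots> = f (y - x + of_int (\<lfloor>x - u\<rfloor> - \<lfloor>y - u\<rfloor>))"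
      by (rule plus_of_int[symmetric])
    also have "y - x + of_int (\<lfloor>x - u\<rfloor> - \<lfloor>y - u\<rfloor>) = frac (y - u) - frac (x - u)"
      by (simp add: frac_def)
    finally show ?thesis .
  qed
  have gaps: "f (u - v) = f (frac (v - u))" "f (v - w) = f (frac (w - u) - frac (v - u))"
    "f (w - z) = f (frac (z - u) - frac (w - u))" "f (z - u) = f (1 - frac (z - u))"
    using f_diff[of u v] f_diff[of v w] f_diff[of w z] by (simp_all add: one_minus f_frac)
  have bounds: "0 \<le> frac (v - u)" "frac (z - u) < 1"
    by (simp_all add: frac_lt_1)
  show ?thesis
    unfolding cyclic_def gaps
    by (rule bexI[of _ "frac (v - u)"], rule bexI[of _ "frac (w - u) - frac (v - u)"],
        rule bexI[of _ "frac (z - u) - frac (w - u)"], rule bexI[of _ "1 - frac (z - u)"])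
      (use assms bounds in \<open>auto simp del: frac_ge_0\<close>)
qed

text \<open>The six orders in which \<open>v\<close>, \<open>w\<close>, \<open>z\<close> can follow
  \<open>u\<close> are identified in pairs by reflection.\<close>

lemma cyclic_cases:
  obtains "cyclic u v w z" | "cyclic u w v z" | "cyclic u v z w"
proof -
  have sorted: "cyclic u a b c \<and> cyclic u c b a"
    if "frac (a - u) \<le> frac (b - u)" "frac (b - u) \<le> frac (c - u)" for a b c
    using cyclic_sorted[OF that] cyclic_reflect by blast
  have "cyclic u v w z \<or> cyclic u w v z \<or> cyclic u v z w"
    using linear[of "frac (v - u)" "frac (w - u)"] linear[of "frac (v - u)" "frac (z - u)"]
      linear[of "frac (w - u)" "frac (z - u)"]
      sorted[of v w z] sorted[of v z w] sorted[of w v z] sorted[of w z v] sorted[of z v w]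
      sorted[of z w v]
    by argo
  then show ?thesis
    using that by blast
qed

section \<open>Lower bounds from pairs of cyclic orders\<close>

text \<open>Half the energy: each unordered pair counts once. The lemmas below on rotations and
  swaps allow the points to be relabelled.\<close>

definition pair_sum where
  "pair_sum p q s t = tensor_potential f (p - q) + tensor_potential f (p - s)
     + tensor_potential f (p - t) + tensor_potential f (q - s)
     + tensor_potential f (q - t) + tensor_potential f (s - t)"

lemma tensor_minus_commute: "tensor_potential f (p - q) = tensor_potential f (q - p)"
  by (simp add: tensor_potential_def case_prod_beta minus_commute[of "fst p"]
      minus_commute[of "snd p"])

lemma pair_sum_rotate: "pair_sum p q s t = pair_sum q s t p"
  unfolding pair_sum_def tensor_minus_commute[of q p] tensor_minus_commute[of s p]
    tensor_minus_commute[of t p] by (simp only: add_ac)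

lemma pair_sum_swap1: "pair_sum p q s t = pair_sum p s q t"
  unfolding pair_sum_def tensor_minus_commute[of s q] by (simp only: add_ac)

lemma pair_sum_swap2: "pair_sum p q s t = pair_sum p q t s"
  unfolding pair_sum_def tensor_minus_commute[of t s] by (simp only: add_ac)

text \<open>The four adjacent pairs have gaps \<open>c\<close> and \<open>d\<close>, eight numbers
  of mean \<open>1/4\<close>; both coordinates of the two diagonals are bounded by
  \<open>f (1/2)\<close>.\<close>

lemma same_cyclic_order:
  assumes "cyclic x0 x1 x2 x3" "cyclic y0 y1 y2 y3"
  shows "2 * profile (1/4) \<le> pair_sum (x0, y0) (x1, y1) (x2, y2) (x3, y3)"
proof -
  obtain c0 c1 c2 c3 where c: "c0 \<in> {0..1}" "c1 \<in> {0..1}" "c2 \<in> {0..1}" "c3 \<in> {0..1}"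
    and c_sum: "c0 + c1 + c2 + c3 = 1"
    and fc: "f (x0 - x1) = f c0" "f (x1 - x2) = f c1" "f (x2 - x3) = f c2" "f (x3 - x0) = f c3"
    using assms(1) unfolding cyclic_def by blast
  obtain d0 d1 d2 d3 where d: "d0 \<in> {0..1}" "d1 \<in> {0..1}" "d2 \<in> {0..1}" "d3 \<in> {0..1}"
    and d_sum: "d0 + d1 + d2 + d3 = 1"
    and fd: "f (y0 - y1) = f d0" "f (y1 - y2) = f d1" "f (y2 - y3) = f d2" "f (y3 - y0) = f d3"
    using assms(2) unfolding cyclic_def by blast
  define p q where "p = (c0 + d0 + c1 + d1) / 4" and "q = (c2 + d2 + c3 + d3) / 4"
  have pq: "p \<in> {0..1}" "q \<in> {0..1}"
    using c d by (auto simp: p_def q_def)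
  have "p + q = (c0 + c1 + c2 + c3) / 4 + (d0 + d1 + d2 + d3) / 4"
    by (simp add: p_def q_def add_divide_distrib)
  then have mean: "(p + q) / 2 = 1/4"
    by (simp add: c_sum d_sum)
  define h where "h = f (1/2)"
  define k where "k = f (1/4)"
  have "2 * profile (1/4) = 2 * (k * k) + 2 * (2 * (k * h))"
    by (simp add: profile_def h_def k_def distrib_left add_ac)
  \<comment> \<open>The mixed product \<open>k * h\<close> of the profile is traded for squares:
    \<open>k * k\<close> comes from adjacent pairs and \<open>h * h\<close> from diagonals.\<close>
  also have "\<dots> \<le> 2 * (k * k) + 2 * (k * k + h * h)"
    by (intro add_left_mono mult_left_mono ennreal_two_mult_le_squares) auto
  also have "\<dots> = 2 * (2 * (k * k)) + (h * h + h * h)"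
    by (simp add: distrib_left mult_2 add_ac)
  also have "\<dots> \<le> 2 * (f p * f p + f q * f q) + (h * h + h * h)"
  proof -
    have "2 * (k * k) \<le> 2 * (f p * f q)"
      unfolding k_def using midpoint[OF pq] unfolding mean by (intro mult_left_mono) auto
    also have "\<dots> \<le> f p * f p + f q * f q"
      by (rule ennreal_two_mult_le_squares)
    finally show ?thesis
      by (intro add_right_mono mult_left_mono) auto
  qed
  also have "\<dots> = 2 * (f p * f p) + 2 * (f q * f q) + (h * h + h * h)"
    by (simp add: distrib_left)
  also have "\<dots> \<le> (f c0 * f d0 + f c1 * f d1) + (f c2 * f d2 + f c3 * f d3)
      + (f (x0 - x2) * f (y0 - y2) + f (x1 - x3) * f (y1 - y3))"
    unfolding p_def q_def h_def
    by (intro add_mono sum_products2 mult_mono f_half_le c d) auto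
  also have "\<dots> = pair_sum (x0, y0) (x1, y1) (x2, y2) (x3, y3)"
    by (simp add: pair_sum_def tensor_potential_def fc[symmetric] fd[symmetric]
        minus_commute[of x3 x0] minus_commute[of y3 y0] add_ac)
  finally show ?thesis .
qed

text \<open>The pairs 12 and 30 are adjacent in both orders, 01 and 23 only in the first, 02 and 13
  only in the second.\<close>

lemma different_cyclic_order:
  assumes "cyclic x0 x1 x2 x3" "cyclic y0 y2 y1 y3"
  shows "\<exists>a\<in>{0..1/2}. 2 * profile a \<le> pair_sum (x0, y0) (x1, y1) (x2, y2) (x3, y3)"
proof -
  obtain c0 c1 c2 c3 where c: "c0 \<in> {0..1}" "c1 \<in> {0..1}" "c2 \<in> {0..1}" "c3 \<in> {0..1}"
    and c_sum: "c0 + c1 + c2 + c3 = 1"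
    and fc: "f (x0 - x1) = f c0" "f (x1 - x2) = f c1" "f (x2 - x3) = f c2" "f (x3 - x0) = f c3"
    using assms(1) unfolding cyclic_def by blast
  obtain d0 d1 d2 d3 where d: "d0 \<in> {0..1}" "d1 \<in> {0..1}" "d2 \<in> {0..1}" "d3 \<in> {0..1}"
    and d_sum: "d0 + d1 + d2 + d3 = 1"
    and fd: "f (y0 - y2) = f d0" "f (y2 - y1) = f d1" "f (y1 - y3) = f d2" "f (y3 - y0) = f d3"
    using assms(2) unfolding cyclic_def by blast
  \<comment> \<open>The mean gap of the four pairs adjacent in one coordinate only. As all eight
    gaps sum to \<open>2\<close>, those of the two common pairs have mean
    \<open>1/2 - a\<close>.\<close>
  define a where "a = (c0 + c2 + d0 + d2) / 4"
  have a: "1/2 - a = (c1 + d1 + c3 + d3) / 4"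
    using c_sum d_sum by (simp add: a_def field_simps)
  have "a \<ge> 0" "1/2 - a \<ge> 0"
    using c d unfolding a by (auto simp: a_def)
  define h where "h = f (1/2)"
  have "2 * profile a = 4 * f a * h + 2 * (f (1/2 - a) * f (1/2 - a))"
    by (simp add: profile_def h_def distrib_left mult.assoc[symmetric])
  also have "\<dots> \<le> (f c0 + f c2 + f d0 + f d2) * h + (f c1 * f d1 + f c3 * f d3)"
    unfolding a unfolding a_def
    by (intro add_mono mult_right_mono mean4 sum_products2 c d) auto
  also have "\<dots> = (f c0 * h + f c2 * h + h * f d0 + h * f d2) + (f c1 * f d1 + f c3 * f d3)"
    by (simp only: distrib_right mult.commute[of h "f d0"] mult.commute[of h "f d2"])
  also have "\<dots> \<le> (f c0 * f (y0 - y1) + f c2 * f (y2 - y3) + f (x0 - x2) * f d0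
      + f (x1 - x3) * f d2) + (f c1 * f d1 + f c3 * f d3)"
    unfolding h_def by (intro add_mono mult_mono f_half_le) auto
  also have "\<dots> = pair_sum (x0, y0) (x1, y1) (x2, y2) (x3, y3)"
    by (simp add: pair_sum_def tensor_potential_def fc[symmetric] fd[symmetric]
        minus_commute[of x3 x0] minus_commute[of y3 y0] minus_commute[of y2 y1] add_ac)
  finally show ?thesis
    using \<open>a \<ge> 0\<close> \<open>1/2 - a \<ge> 0\<close> by auto
qed

text \<open>Two different cyclic orders share exactly two disjoint adjacent pairs. Rotating and
  relabelling brings these to the positions 12 and 30 of \<open>different_cyclic_order\<close>,
  which settles six of the nine cases.\<close>

lemma pair_sum_ge_profile:
  "\<exists>a\<in>{0..1/2}. 2 * profile a \<le> pair_sum (x0, y0) (x1, y1) (x2, y2) (x3, y3)"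
proof -
  have quarter: "(1/4::real) \<in> {0..1/2}"
    by auto
  note rot = pair_sum_rotate and swap1 = pair_sum_swap1 and swap2 = pair_sum_swap2
  show ?thesis
  proof (cases rule: cyclic_cases[of x0 x1 x2 x3])
    case x: 1
    show ?thesis
    proof (cases rule: cyclic_cases[of y0 y1 y2 y3])
      case 1
      from same_cyclic_order[OF x 1] quarter show ?thesis by blast
    next
      case 2
      from different_cyclic_order[OF x 2] show ?thesis .
    next
      case 3
      from different_cyclic_order[OF cyclic_rotate[OF x] cyclic_rotate[OF 3]]
      show ?thesis by (simp add: rot[of "(x0, y0)"])
    qed
  next
    case x: 2
    show ?thesis
    proof (cases rule: cyclic_cases[of y0 y1 y2 y3])
      case 1
      from different_cyclic_order[OF x 1] show ?thesis
        by (simp add: swap1[of "(x0, y0)" "(x1, y1)"])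
    next
      case 2
      from same_cyclic_order[OF x 2] quarter show ?thesis
        by (auto simp: swap1[of "(x0, y0)" "(x1, y1)"])
    next
      case 3
      from different_cyclic_order[OF cyclic_rotate[OF cyclic_rotate[OF cyclic_rotate[OF x]]]
          cyclic_rotate[OF cyclic_rotate[OF 3]]]
      show ?thesis
        by (simp add: rot[of "(x3, y3)"] swap1[of "(x0, y0)" "(x1, y1)"])
    qed
  next
    case x: 3
    show ?thesis
    proof (cases rule: cyclic_cases[of y0 y1 y2 y3])
      case 1
      from different_cyclic_order[OF cyclic_rotate[OF x] cyclic_rotate[OF 1]]
      show ?thesis
        by (simp add: rot[of "(x0, y0)"] swap1[of "(x1, y1)" "(x2, y2)"])
    next
      case 2
      from different_cyclic_order[OF cyclic_rotate[OF cyclic_rotate[OF x]]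
          cyclic_rotate[OF cyclic_rotate[OF cyclic_rotate[OF 2]]]]
      show ?thesis
        by (simp add: rot[of "(x3, y3)"] rot[of "(x2, y2)"] swap2[of "(x0, y0)" "(x1, y1)" "(x2, y2)"])
    next
      case 3
      from same_cyclic_order[OF x 3] quarter show ?thesis
        by (auto simp: swap2[of "(x0, y0)" "(x1, y1)" "(x2, y2)"])
    qed
  qed
qed

section \<open>Reduction of the energy problem to the profile\<close>

lemma energy_eq_pair_sum:
  "energy (tensor_potential f) [p, q, s, t] = 2 * pair_sum p q s t"
proof -
  let ?X = "[p, q, s, t]" and ?F = "tensor_potential f"
  have pairs: "{(k, l). k < n \<and> l < n \<and> k \<noteq> l} = (SIGMA k:{..<n}. {..<n} - {k})" for n :: nat
    by auto
  have "energy ?F ?X =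
      (\<Sum>k<length ?X. \<Sum>l\<in>{..<length ?X} - {k}. ?F (?X ! k - ?X ! l))"
    unfolding energy_def pairs by (rule sum.Sigma[symmetric]) auto
  also have "length ?X = 4"
    by simp
  also have "{..<4::nat} = {0, 1, 2, 3}"
    by auto
  also have "(\<Sum>k\<in>{0, 1, 2, 3}. \<Sum>l\<in>{0, 1, 2, 3} - {k}. ?F (?X ! k - ?X ! l)) =
      (?F (p - q) + ?F (p - s) + ?F (p - t)) + (?F (q - p) + ?F (q - s) + ?F (q - t))
      + (?F (s - p) + ?F (s - q) + ?F (s - t)) + (?F (t - p) + ?F (t - q) + ?F (t - s))"
    by (simp add: insert_Diff_if add_ac)
  also have "\<dots> = 2 * pair_sum p q s t"
    unfolding pair_sum_def mult_2 tensor_minus_commute[of q p] tensor_minus_commute[of s p]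
      tensor_minus_commute[of t p] tensor_minus_commute[of s q] tensor_minus_commute[of t q]
      tensor_minus_commute[of t s]
    by (simp only: add_ac)
  finally show ?thesis .
qed

lemma energy_ge_profile:
  assumes "configuration 4 Y"
  shows "\<exists>a\<in>{0..1/2}. 4 * profile a \<le> energy (tensor_potential f) Y"
proof -
  have "length Y = 4"
    using assms by (simp add: configuration_def)
  then obtain p q s t where Y: "Y = [p, q, s, t]"
    by (auto simp: numeral_eq_Suc length_Suc_conv)
  obtain a where a: "a \<in> {0..1/2}" "2 * profile a \<le> pair_sum p q s t"
    using pair_sum_ge_profile[of "fst p" "snd p" "fst q" "snd q" "fst s" "snd s" "fst t" "snd t"]
    by auto
  have "4 * profile a = 2 * (2 * profile a)"
    by (simp add: mult.assoc[symmetric])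
  also have "\<dots> \<le> energy (tensor_potential f) Y"
    unfolding Y energy_eq_pair_sum using a by (intro mult_left_mono) auto
  finally show ?thesis
    using a by blast
qed

lemma energy_X4: "energy (tensor_potential f) (X4 a) = 4 * profile a"
proof -
  \<comment> \<open>The coordinate difference \<open>1/2 + a\<close> has distance
    \<open>1/2 - a\<close> on the circle, so the first and last points contribute as much as the
    middle two.\<close>
  have f_eqs: "f (- (1/2)) = f (1/2)" "f (- a) = f a" "f (- (1/2) - a) = f (1/2 - a)"
     "f (a - 1/2) = f (1/2 - a)"
    using f_even[of "1/2"] f_even[of a] plus_1[of "- (1/2) - a"] minus_commute[of a "1/2"]
    by (simp_all add: algebra_simps)
  define A B where "A = f a * f (1/2)" and "B = f (1/2 - a) * f (1/2 - a)"
  have "pair_sum (0, 0) (a, 1/2) (1/2, a) (1/2 + a, 1/2 + a) = A + A + B + B + A + A"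
    by (simp add: pair_sum_def tensor_potential_def f_eqs mult.commute[of "f (1/2)"] A_def B_def)
  also have "2 * \<dots> = 2 * (2 * (2 * A + B))"
    by (simp only: mult_2 add_ac)
  also have "\<dots> = 4 * profile a"
    by (simp add: profile_def A_def B_def mult.assoc[symmetric])
  finally show ?thesis
    unfolding X4_def energy_eq_pair_sum .
qed

lemma configuration_X4: "a \<in> {0<..<1/2} \<Longrightarrow> configuration 4 (X4 a)"
  by (auto simp: configuration_def X4_def torus2_def)

lemma energy_minimizerI:
  assumes "a \<in> {0<..<1/2}" "\<And>b. b \<in> {0..1/2} \<Longrightarrow> profile a \<le> profile b"
  shows "energy_minimizer (tensor_potential f) 4 (X4 a)"
  unfolding energy_minimizer_def
proof (intro conjI allI impI)
  fix Y assume "configuration 4 Y"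
  then obtain b where b: "b \<in> {0..1/2}" "4 * profile b \<le> energy (tensor_potential f) Y"
    using energy_ge_profile by blast
  have "4 * profile a \<le> 4 * profile b"
    using assms(2)[OF b(1)] by (intro mult_left_mono) auto
  with b show "energy (tensor_potential f) (X4 a) \<le> energy (tensor_potential f) Y"
    by (simp add: energy_X4)
qed (use assms configuration_X4 in blast)

lemma profile_eq:
  assumes "f a < \<infinity>" "f (1/2 - a) < \<infinity>"
  shows "profile a = ennreal (2 * r a * r (1/2) + r (1/2 - a) ^ 2)"
  using assms f_finite[of "1/2"]
  by (simp add: profile_def f_eq ennreal_mult r_nonneg power2_eq_square mult.assoc)

lemma profile_le_iff:
  assumes "f a < \<infinity>" "f (1/2 - a) < \<infinity>" "f b < \<infinity>" "f (1/2 - b) < \<infinity>"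
  shows "profile a \<le> profile b \<longleftrightarrow>
    2 * r a * r (1/2) + r (1/2 - a) ^ 2 \<le> 2 * r b * r (1/2) + r (1/2 - b) ^ 2"
  unfolding profile_eq[OF assms(1,2)] profile_eq[OF assms(3,4)]
  by (rule ennreal_le_iff) (simp add: r_nonneg)

lemma energy_minimizerD:
  assumes "energy_minimizer (tensor_potential f) 4 (X4 a)"
    and "a \<in> {0<..<1/2}" "b \<in> {0<..<1/2}"
  shows "2 * r a * r (1/2) + r (1/2 - a) ^ 2 \<le> 2 * r b * r (1/2) + r (1/2 - b) ^ 2"
proof -
  have "energy (tensor_potential f) (X4 a) \<le> energy (tensor_potential f) (X4 b)"
    using assms configuration_X4[of b] by (simp only: energy_minimizer_def)
  then have "4 * profile a \<le> 4 * profile b"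
    by (simp only: energy_X4)
  then have "profile a \<le> profile b"
    by (subst (asm) ennreal_mult_le_mult_iff) auto
  then show ?thesis
    using assms(2,3) f_finite profile_le_iff[of a b] by simp
qed

text \<open>Continuity with values in \<open>ennreal\<close> includes infinite endpoint values, so
  compactness yields a minimum for singular potentials too.\<close>

lemma continuous_on_profile: "continuous_on {0..1/2} profile"
  unfolding continuous_on_def
proof
  fix a :: real assume a: "a \<in> {0..1/2}"
  have nz: "f x \<noteq> 0" for x
    using f_pos[of x] by simp
  have "(f \<longlongrightarrow> f a) (at a within {0..1/2})"
    using a isCont_f[of a] by (auto simp: isCont_def intro: tendsto_within_subset)
  moreover have "((\<lambda>x. f (1/2 - x)) \<longlongrightarrow> f (1/2 - a)) (at a within {0..1/2})"
  proof (rule isCont_tendsto_compose[where g = f])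
    show "isCont f (1/2 - a)"
      using a by (intro isCont_f) auto
    show "((\<lambda>x. 1/2 - x) \<longlongrightarrow> 1/2 - a) (at a within {0..1/2})"
      by (intro tendsto_intros)
  qed
  ultimately show "(profile \<longlongrightarrow> profile a) (at a within {0..1/2})"
    unfolding profile_def
    by (intro tendsto_add tendsto_mult_ennreal tendsto_const) (use nz in auto)
qed

end

section \<open>Critical points, existence and uniqueness for differentiable potentials\<close>

locale differentiable_log_convex_potential = log_convex_potential +
  assumes differentiable: "real_potential f differentiable_on {0<..<1}"
begin

lemma r_has_derivative:
  assumes "0 < t" "t < 1"
  shows "(r has_real_derivative deriv r t) (at t)"
proof -
  have "r differentiable (at t)"
    using differentiable assms by (auto simp: differentiable_on_eq_differentiable_at)
  then show ?thesis
    using DERIV_deriv_iff_real_differentiable by blast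
qed

text \<open>By \<open>f_half_le\<close>, \<open>1/2\<close> is an interior minimum.\<close>

lemma r_has_derivative_half: "(r has_real_derivative 0) (at (1/2))"
proof -
  have "r (1/2) \<le> r y" if "\<bar>1/2 - y\<bar> < 1/2" for y
  proof -
    have "0 < y" "y < 1"
      using that by linarith+
    then show ?thesis
      using f_half_le[of y] f_finite[of y] f_finite[of "1/2"] by (simp add: r_le_iff)
  qed
  then have "deriv r (1/2) = 0"
    by (intro DERIV_local_min[OF r_has_derivative, of "1/2" "1/2"]) auto
  then show ?thesis
    using r_has_derivative[of "1/2"] by simp
qed

text \<open>Comparison with the configurations \<open>X4 b\<close> makes \<open>a\<close> an
  interior minimum of \<open>G\<close>, whose derivative therefore vanishes.\<close>

lemma minimizer_derivative:
  assumes "energy_minimizer (tensor_potential f) 4 (X4 a)" "a \<in> {0<..<1/2}"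
  shows "deriv r a * r (1/2) = deriv r (1/2 - a) * r (1/2 - a)"
proof -
  define G where "G b = 2 * r b * r (1/2) + r (1/2 - b) ^ 2" for b
  have r1: "(r has_real_derivative deriv r a) (at a)"
    using assms by (intro r_has_derivative) auto
  have "(r has_real_derivative deriv r (1/2 - a)) (at (1/2 - a))"
    using assms by (intro r_has_derivative) auto
  then have r2: "((\<lambda>b. r (1/2 - b)) has_real_derivative deriv r (1/2 - a) * (-1)) (at a)"
    by (rule DERIV_chain2) (auto intro!: derivative_eq_intros)
  have "(G has_real_derivative
      2 * deriv r a * r (1/2) - 2 * r (1/2 - a) * deriv r (1/2 - a)) (at a)"
    unfolding G_def by (rule derivative_eq_intros r1 r2 refl)+ simp
  moreover have "\<forall>b. \<bar>a - b\<bar> < min a (1/2 - a) \<longrightarrow> G a \<le> G b"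
    unfolding G_def using assms by (auto intro!: energy_minimizerD)
  ultimately have "2 * deriv r a * r (1/2) - 2 * r (1/2 - a) * deriv r (1/2 - a) = 0"
    using assms(2) by (intro DERIV_local_min[of G _ a "min a (1/2 - a)"]) auto
  then show ?thesis
    by simp
qed

text \<open>The difference quotients with step \<open>- (1/2) ^ Suc n\<close> are at most
  \<open>- 2 * K\<close> and tend to \<open>0\<close>. Dyadic steps suit the estimates that repeated
  halving gives.\<close>

lemma zero_derivative_bound:
  assumes "(q has_real_derivative 0) (at (1/2))"
    and "\<And>n. K * (1/2) ^ n \<le> q (1/2 - (1/2) ^ Suc n) - q (1/2)"
  shows "K \<le> 0"
proof -
  have "((\<lambda>h. (q (1/2 + h) - q (1/2)) / h) \<longlongrightarrow> 0) (at 0)"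
    using assms(1) by (simp add: DERIV_def)
  moreover have "filterlim (\<lambda>n. - ((1/2::real) ^ Suc n)) (at 0) sequentially"
  proof (rule filterlim_atI)
    have "(\<lambda>n. - (1/2 * (1/2::real) ^ n)) \<longlonglongrightarrow> - (1/2 * 0)"
      by (intro tendsto_intros LIMSEQ_realpow_zero) auto
    then show "(\<lambda>n. - ((1/2::real) ^ Suc n)) \<longlonglongrightarrow> 0"
      by simp
  qed simp
  ultimately have "(\<lambda>n. (q (1/2 + - ((1/2) ^ Suc n)) - q (1/2)) / - ((1/2) ^ Suc n))
      \<longlonglongrightarrow> 0"
    by (rule filterlim_compose)
  moreover have "(q (1/2 + - ((1/2) ^ Suc n)) - q (1/2)) / - ((1/2) ^ Suc n) \<le> - 2 * K" for n
    using assms(2)[of n] by (simp add: field_simps)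
  ultimately have "0 \<le> - 2 * K"
    by (intro LIMSEQ_le_const2) auto
  then show ?thesis
    by simp
qed

text \<open>At an endpoint, one of the two terms of the profile has derivative \<open>0\<close> because
  \<open>f'(1/2) = 0\<close>, while the other one changes at least linearly unless \<open>f\<close> is constant.\<close>

lemma endpoint_minimum_imp_const:
  assumes "b = 0 \<or> b = 1/2" "\<And>t. t \<in> {0..1/2} \<Longrightarrow> profile b \<le> profile t"
    and "t \<in> {0..1/2}"
  shows "f t = f (1/2)"
proof -
  \<comment> \<open>An endpoint \<open>b\<close> puts \<open>f 0\<close> into a term of the profile
    with nonzero factors. Since the minimum is finite, the potential cannot be singular.\<close>
  have "profile (1/4) < \<infinity>"
    using f_finite[of "1/4"] by (subst profile_eq) auto
  then have "profile b < \<infinity>"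
    using assms(2)[of "1/4"] by (auto simp: less_top[symmetric] top_unique)
  moreover have "profile b = \<infinity>" if "f 0 = \<infinity>"
  proof (cases "b = 0")
    case True
    then show ?thesis
      using f_pos[of "1/2"] that by (simp add: profile_def ennreal_mult_top ennreal_top_mult)
  next
    case False
    with assms(1) have "b = 1/2"
      by simp
    then show ?thesis
      using that by (simp only: profile_def) simp
  qed
  ultimately have f0: "f 0 < \<infinity>"
    by (metis infinity_ennreal_def less_irrefl less_top)
  have fin: "f t < \<infinity>" if "t \<in> {0..1/2}" for t
    using that f0 f_finite[of t] by (cases "t = 0") auto
  have le: "2 * r b * r (1/2) + r (1/2 - b) ^ 2 \<le> 2 * r t * r (1/2) + r (1/2 - t) ^ 2"
    if "t \<in> {0..1/2}" for t
  proof -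
    have "b \<in> {0..1/2}" "1/2 - b \<in> {0..1/2}" "1/2 - t \<in> {0..1/2}"
      using assms(1) that by auto
    then show ?thesis
      using assms(2)[OF that] fin that profile_le_iff[of b t] by blast
  qed
  define F where "F = r (1/2)"
  define D where "D = r 0 - F"
  have F: "0 < F"
    unfolding F_def by (rule r_pos) auto
  have D: "0 \<le> D"
    using f_half_le[of 0] f0 f_finite[of "1/2"] by (simp add: D_def F_def r_le_iff)
  have pow: "(1/2) ^ Suc n \<in> {0..1/2::real}" for n
    using power_le_one[of "1/2 :: real" n] by simp
  \<comment> \<open>By midpoint convexity, halving the distance to \<open>0\<close> keeps at least
    half of the drop from \<open>r 0\<close>; the initial drop, at \<open>1/2\<close>, is
    \<open>D\<close>.\<close>
  have slope: "D * (1/2) ^ n \<le> r 0 - r ((1/2) ^ Suc n)" for n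
  proof (induction n)
    case 0
    then show ?case by (simp add: D_def F_def)
  next
    case (Suc n)
    define t :: real where "t = (1/2) ^ Suc n"
    have t: "t \<in> {0..1/2}" "t / 2 \<in> {0..1/2}"
      using pow[of n] pow[of "Suc n"] by (auto simp: t_def)
    then have "2 * f ((0 + t) / 2) \<le> f 0 + f t"
      by (intro mean2) auto
    then have "ennreal (2 * r (t / 2)) \<le> ennreal (r 0 + r t)"
      using fin t f0 by (simp add: f_eq ennreal_mult ennreal_plus r_nonneg)
    then have "2 * r (t / 2) \<le> r 0 + r t"
      by (subst (asm) ennreal_le_iff) (simp_all add: r_nonneg)
    then show ?case
      using Suc.IH by (simp add: t_def)
  qed
  have "D \<le> 0"
  proof (cases "b = 0")
    case True
    \<comment> \<open>Minimality at \<open>0\<close> bounds the increment of \<open>r ^ 2\<close>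
      from \<open>1/2\<close> to \<open>1/2 - t\<close> below by
      \<open>2 * F * (r 0 - r t)\<close>.\<close>
    have "2 * F * D \<le> 0"
    proof (rule zero_derivative_bound[where q = "\<lambda>t. r t ^ 2"])
      show "((\<lambda>t. r t ^ 2) has_real_derivative 0) (at (1/2))"
        by (rule derivative_eq_intros r_has_derivative_half refl)+ simp
      show "2 * F * D * (1/2) ^ n \<le> (r (1/2 - (1/2) ^ Suc n))\<^sup>2 - (r (1/2))\<^sup>2" for n
      proof -
        have "2 * F * (D * (1/2) ^ n) \<le> 2 * F * (r 0 - r ((1/2) ^ Suc n))"
          using F slope by (intro mult_left_mono) auto
        then show ?thesis
          using le[OF pow[of n]] True unfolding F_def by (simp add: algebra_simps)
      qed
    qed
    then show ?thesis
      using F by (simp add: mult_le_0_iff)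
  next
    case False
    with assms(1) have b: "b = 1/2"
      by simp
    \<comment> \<open>Minimality at \<open>1/2\<close> bounds the increment of
      \<open>2 * F * r\<close> below by \<open>(r 0 + r t) * (r 0 - r t)\<close>, which is at least
      \<open>r 0 * (r 0 - r t)\<close>.\<close>
    have "r 0 * D \<le> 0"
    proof (rule zero_derivative_bound[where q = "\<lambda>t. 2 * F * r t"])
      show "((\<lambda>t. 2 * F * r t) has_real_derivative 0) (at (1/2))"
        by (rule derivative_eq_intros r_has_derivative_half refl)+ simp
      show "r 0 * D * (1/2) ^ n \<le> 2 * F * r (1/2 - (1/2) ^ Suc n) - 2 * F * r (1/2)" for n
      proof -
        define t :: real where "t = (1/2) ^ Suc n"
        have "1/2 - t \<in> {0..1/2}"
          using pow[of n] by (auto simp: t_def)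
        from le[OF this] have "r 0 ^ 2 - r t ^ 2 \<le> 2 * F * r (1/2 - t) - 2 * F * r (1/2)"
          unfolding F_def by (simp add: b algebra_simps power2_eq_square)
        moreover have "r 0 * (D * (1/2) ^ n) \<le> (r 0 + r t) * (r 0 - r t)"
          using slope[of n] D by (intro mult_mono) (auto simp: t_def r_nonneg)
        ultimately show ?thesis
          by (simp add: t_def algebra_simps power2_eq_square)
      qed
    qed
    then show ?thesis
      using F D unfolding D_def by (simp add: mult_le_0_iff)
  qed
  with D have "f 0 = f (1/2)"
    using f_eq[OF f0] f_eq[OF f_finite[of "1/2"]] by (simp add: D_def F_def)
  then show ?thesis
    using f_half_le[of t] f_le_f0[of t] assms(3) by auto
qed

lemma minimizer_exists: "\<exists>a\<in>{0<..<1/2}. energy_minimizer (tensor_potential f) 4 (X4 a)"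
proof -
  obtain b where b: "b \<in> {0..1/2}" "\<And>t. t \<in> {0..1/2} \<Longrightarrow> profile b \<le> profile t"
    using continuous_attains_inf[OF _ _ continuous_on_profile] by auto
  show ?thesis
  proof (cases "b = 0 \<or> b = 1/2")
    case False
    with b show ?thesis
      by (intro bexI[of _ b] energy_minimizerI) auto
  next
    \<comment> \<open>Here \<open>f\<close> is constant, so every parameter is optimal and the inner
      point \<open>1/4\<close> serves.\<close>
    case True
    have const: "f t = f (1/2)" if "t \<in> {0..1/2}" for t
      by (rule endpoint_minimum_imp_const[OF True b(2) that])
    have "profile (1/4) = profile t" if "t \<in> {0..1/2}" for t
      using that const[of "1/4"] const[of t] const[of "1/2 - t"] by (simp add: profile_def)
    then show ?thesis
      by (intro bexI[of _ "1/4"] energy_minimizerI) auto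
  qed
qed

text \<open>At the midpoint \<open>m\<close> of two distinct minimizers the profile would lie
  strictly below their common value: strict logarithmic convexity makes the first term strictly
  convex, and the squared term is midpoint convex.\<close>

lemma minimizer_unique:
  assumes strict: "strictly_log_convex_on {0<..1/2} r"
    and a: "a \<in> {0<..<1/2}" "energy_minimizer (tensor_potential f) 4 (X4 a)"
    and b: "b \<in> {0<..<1/2}" "energy_minimizer (tensor_potential f) 4 (X4 b)"
  shows "a = b"
proof (rule ccontr)
  assume "a \<noteq> b"
  define m where "m = (a + b) / 2"
  have m: "m \<in> {0<..<1/2}"
    using a b by (auto simp: m_def)
  have pos: "0 < r a" "0 < r b" "0 < r m" "0 < r (1/2)"
    using a b m by (auto intro!: r_pos)
  have "\<forall>x\<in>{0<..1/2}. \<forall>y\<in>{0<..1/2}. \<forall>u>0. \<forall>v>0. x \<noteq> y \<longrightarrow> u + v = 1 \<longrightarrow>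
      ln (r (u * x + v * y)) < u * ln (r x) + v * ln (r y)"
    using strict unfolding strictly_log_convex_on_def strictly_convex_on_def by blast
  from this[rule_format, of a b "1/2" "1/2"]
  have "ln (r (1/2 * a + 1/2 * b)) < 1/2 * ln (r a) + 1/2 * ln (r b)"
    using a(1) b(1) \<open>a \<noteq> b\<close> by simp
  then have "2 * ln (r m) < ln (r a) + ln (r b)"
    by (simp add: m_def add_divide_distrib)
  then have "ln (r m * r m) < ln (r a * r b)"
    using pos by (simp add: ln_mult)
  then have "r m * r m < r a * r b"
    using pos by simp
  moreover have "4 * (r a * r b) \<le> (r a + r b)\<^sup>2"
    using zero_le_power2[of "r a - r b"] by (simp add: power2_eq_square algebra_simps)
  ultimately have "(2 * r m)\<^sup>2 < (r a + r b)\<^sup>2"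
    by (simp add: power2_eq_square)
  then have "2 * r m < r a + r b"
    by (rule power_less_imp_less_base) (use pos in simp)
  then have "2 * (2 * r m * r (1/2)) < 2 * r a * r (1/2) + 2 * r b * r (1/2)"
    using mult_strict_right_mono[of "2 * r m" "r a + r b" "2 * r (1/2)"] pos
    by (simp add: algebra_simps)
  moreover have "2 * (r (1/2 - m))\<^sup>2 \<le> (r (1/2 - a))\<^sup>2 + (r (1/2 - b))\<^sup>2"
  proof -
    have mean: "((1/2 - a) + (1/2 - b)) / 2 = 1/2 - m"
      by (simp add: m_def field_simps)
    have "r (1/2 - m) * r (1/2 - m) \<le> r (1/2 - a) * r (1/2 - b)"
      using r_midpoint_half[of "1/2 - a" "1/2 - b", unfolded mean] a(1) b(1) by simp
    then show ?thesis
      using zero_le_power2[of "r (1/2 - a) - r (1/2 - b)"]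
      by (simp add: power2_eq_square algebra_simps)
  qed
  ultimately show False
    using energy_minimizerD[OF a(2,1) m] energy_minimizerD[OF b(2,1) m] by linarith
qed

end

theorem proposition5p2:
  fixes f :: "real \<Rightarrow> ennreal"
  assumes "torus_potential f"
    and "real_potential f differentiable_on {0<..<1}"
    and "antimono_on {0<..1/2} f"
    and "log_convex_on {0<..1/2} (real_potential f)"
  shows "(\<exists>a\<in>{0<..<1/2}. energy_minimizer (tensor_potential f) 4 (X4 a)) \<and>
    (\<forall>a\<in>{0<..<1/2}. energy_minimizer (tensor_potential f) 4 (X4 a) \<longrightarrow>
       deriv (real_potential f) a * real_potential f (1/2) =
       deriv (real_potential f) (1/2 - a) * real_potential f (1/2 - a)) \<and>
    (strictly_log_convex_on {0<..1/2} (real_potential f) \<longrightarrow>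
       (\<exists>!a. a \<in> {0<..<1/2} \<and> energy_minimizer (tensor_potential f) 4 (X4 a)))"
proof -
  interpret differentiable_log_convex_potential f
    using assms by unfold_locales
  show ?thesis
    using minimizer_exists minimizer_derivative minimizer_unique by blast
qed

end
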